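(* Let $m\ge2$ and let the real sequences $(a_n)_{n\ge0}$, $(b_n)_{n\ge0}$ satisfy $a_j=b_j$ for $0\le j\le m-2$ and $$a_n=b_n+\frac{m}{\binom{n}{m-1}}\sum_{j=0}^{n-(m-1)}\binom{n-1-j}{m-2}a_j,\qquad n\ge m-1 .$$ (a) If $b_n=o(n)$ and $\sum_{n=0}^\infty\frac{b_n}{(n+1)(n+2)}$ converges (not necessarily absolutely), then $$a_n=\frac{K_1}{H_m-1}\,n+o(n),\qquad K_1:=\sum_{j=0}^\infty\frac{b_j}{(j+1)(j+2)} .$$ (b) If $b_n=K_2(n+1)+h_n$ for all $n\ge 0$, where $K_2$ is a constant, $h_n=o(n)$ and $\sum_{n=0}^\infty\frac{h_n}{(n+1)(n+2)}$ converges, then $$a_n=\frac{K_2}{H_m-1}\,nH_n+\frac{K_3}{H_m-1}\,n+o(n),$$ where $$K_3:=\sum_{j=0}^\infty\frac{h_j}{(j+1)(j+2)}+K_2\left[\frac{H_m-1}{2}-1+\frac{H_m^{(2)}-1}{2(H_m-1)}\right].$$ (c) If $b_n=K_4n^v+o(n^v)$ with constants $K_4$ and $v>1$, then $$a_n=\frac{K_4}{1-\frac{m!\,\Gamma(v+1)}{\Gamma(v+m)}}\,n^v+o(n^v).$$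
   Context: $H_n=\sum_{j=1}^n 1/j$ and $H_n^{(2)}=\sum_{j=1}^n1/j^2$. *)

theory Defs
  imports "HOL-Analysis.Analysis" "HOL-Library.Landau_Symbols"
begin

definition harm2 :: "nat \<Rightarrow> real" where
  "harm2 n = (\<Sum>j=1..n. 1 / (real j)\<^sup>2)"

definition K1 :: "(nat \<Rightarrow> real) \<Rightarrow> real" where
  "K1 b = (\<Sum>j. b j / ((real j + 1) * (real j + 2)))"

definition K3 :: "nat \<Rightarrow> real \<Rightarrow> (nat \<Rightarrow> real) \<Rightarrow> real" where
  "K3 m K2 h = (\<Sum>j. h j / ((real j + 1) * (real j + 2))) +
     K2 * ((harm m - 1) / 2 - 1 + (harm2 m - 1) / (2 * (harm m - 1)))"

end

theory Submission
  imports Defs "HOL-Computational_Algebra.Fundamental_Theorem_Algebra" "HOL-Real_Asymp.Real_Asymp"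
begin

text \<open>
  Let \<open>C\<close> and \<open>B\<close> be the generating functions of \<open>a - b\<close> and \<open>b\<close>, and \<open>\<theta> = (1 - z) d/dz\<close>.
  The recurrence is the Euler equation \<open>P(\<theta>) C = m! B\<close> with
  \<open>P(\<lambda>) = \<lambda> (\<lambda> + 1) \<dots> (\<lambda> + m - 2) - m!\<close>. Over the complex numbers \<open>P(\<theta>)\<close> factors into operators
  \<open>\<theta> - l\<close>, and \<open>(\<theta> - l) X = Y\<close> is the recurrence \<open>(n + 1) x\<^sub>n\<^sub>+\<^sub>1 = (n + l) x\<^sub>n + y\<^sub>n\<close>, which maps
  expansions \<open>\<alpha> n\<^sup>v H\<^sub>n + \<beta> n\<^sup>v + o(n\<^sup>v)\<close> of \<open>y\<close> to such expansions of \<open>x\<close> as soon as \<open>Re l < v + 1\<close>.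
  The number 2 is a simple root of \<open>P\<close>, and comparing moduli in \<open>P(\<lambda>) = 0\<close> shows that all other roots
  have real part less than 2. For \<open>v > 1\<close> all factors can thus be inverted at once. For \<open>v = 1\<close> the
  factor \<open>\<theta> - 2\<close> is solved exactly, which produces the partial sums of \<open>b\<^sub>j / ((j + 1) (j + 2))\<close>.
\<close>

section \<open>First-order recurrences\<close>

text \<open>Here |n + l| = n + Re l + o(1), while (n + 1)^(s+1) / n^s = n + s + 1 + o(1), so the
  slack tends to s + 1 - Re l, which exceeds \<open>d\<close>.\<close>

lemma powr_supersolution:
  fixes l :: complex and s d :: real
  assumes "d < s + 1 - Re l"
  shows "eventually (\<lambda>n. (norm (of_nat n + l) + d) * real n powr s \<le> (real n + 1) powr (s + 1)) sequentially"
proof -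
  have norm_eq: "norm (of_nat n + l) = sqrt ((real n + Re l)\<^sup>2 + (Im l)\<^sup>2)" for n
    by (simp add: norm_complex_def)
  have "(\<lambda>n. ((real n + 1) powr (s + 1) - norm (of_nat n + l) * real n powr s) / real n powr s)
          \<longlonglongrightarrow> s + 1 - Re l"
    unfolding norm_eq by real_asymp
  then have "eventually (\<lambda>n. d < ((real n + 1) powr (s + 1) - norm (of_nat n + l) * real n powr s)
      / real n powr s) sequentially"
    using assms by (rule order_tendstoD)
  with eventually_gt_at_top[of 0] show ?thesis
    by eventually_elim (simp add: field_simps)
qed

text \<open>A solution is dominated by \<open>\<epsilon> n\<^sup>v + M n\<^sup>s\<close>, a supersolution for any \<open>s\<close> with
  \<open>Re l - 1 < s < v\<close>.\<close>

lemma smallo_first_order_recurrence: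
  fixes x :: "nat \<Rightarrow> complex" and l :: complex and v :: real
  assumes l: "Re l < v + 1"
    and y: "(\<lambda>n. (of_nat n + 1) * x (Suc n) - (of_nat n + l) * x n) \<in> o(\<lambda>n. of_real (real n powr v))"
  shows "x \<in> o(\<lambda>n. of_real (real n powr v))"
proof (rule landau_o.smallI)
  fix c :: real
  assume "c > 0"
  \<comment> \<open>Half of \<open>c\<close> goes to each term of the bound. The slack \<delta> lets
    \<epsilon> n^v absorb an inhomogeneity of size \<epsilon> \<delta> n^v; the exponent
    \<open>s\<close>, midway between Re l - 1 and v, carries the initial value and needs no
    slack.\<close>
  define \<epsilon> where "\<epsilon> = c / 2"
  define \<delta> where "\<delta> = (v + 1 - Re l) / 2"
  define s where "s = (Re l - 1 + v) / 2"
  have pos: "\<epsilon> > 0" "\<delta> > 0" and "\<epsilon> * \<delta> > 0"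
    using \<open>c > 0\<close> l by (auto simp: \<epsilon>_def \<delta>_def)
  have s: "s < v" "0 < s + 1 - Re l" and \<delta>: "\<delta> < v + 1 - Re l"
    using l by (auto simp: s_def \<delta>_def field_simps)
  have "eventually (\<lambda>n. norm ((of_nat n + 1) * x (Suc n) - (of_nat n + l) * x n)
      \<le> \<epsilon> * \<delta> * real n powr v) sequentially"
    using landau_o.smallD[OF y \<open>\<epsilon> * \<delta> > 0\<close>] by simp
  then have "eventually (\<lambda>n. norm ((of_nat n + 1) * x (Suc n) - (of_nat n + l) * x n)
        \<le> \<epsilon> * \<delta> * real n powr v \<and>
      (norm (of_nat n + l) + \<delta>) * real n powr v \<le> (real n + 1) powr (v + 1) \<and>
      (norm (of_nat n + l) + 0) * real n powr s \<le> (real n + 1) powr (s + 1) \<and> 0 < n) sequentially"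
    using powr_supersolution[OF \<delta>] powr_supersolution[OF s(2)] eventually_gt_at_top[of "0::nat"]
    by (intro eventually_conj)
  then obtain N where N: "norm ((of_nat n + 1) * x (Suc n) - (of_nat n + l) * x n) \<le> \<epsilon> * \<delta> * real n powr v"
      "(norm (of_nat n + l) + \<delta>) * real n powr v \<le> (real n + 1) powr (v + 1)"
      "norm (of_nat n + l) * real n powr s \<le> (real n + 1) powr (s + 1)" "0 < n" if "n \<ge> N" for n
    unfolding eventually_sequentially by auto
  \<comment> \<open>Chosen so that M n^s alone already bounds \<open>x\<close> at n = N.\<close>
  define M where "M = norm (x N) / real N powr s"
  have "M \<ge> 0" by (simp add: M_def)
  have bound: "norm (x n) \<le> \<epsilon> * real n powr v + M * real n powr s" if "n \<ge> N" for n
    using that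
  proof (induction n rule: dec_induct)
    case base
    show ?case using N(4)[of N] pos by (simp add: M_def)
  next
    case (step n)
    let ?t = "norm (of_nat n + l)"
    have "(real n + 1) * norm (x (Suc n)) = norm ((of_nat n + 1) * x (Suc n))"
      by (metis norm_mult norm_of_nat of_nat_Suc add.commute)
    also have "\<dots> \<le> norm ((of_nat n + l) * x n) + \<epsilon> * \<delta> * real n powr v"
      using N(1)[of n] step.hyps norm_triangle_sub[of "(of_nat n + 1) * x (Suc n)" "(of_nat n + l) * x n"]
      by simp
    also have "norm ((of_nat n + l) * x n) \<le> ?t * (\<epsilon> * real n powr v + M * real n powr s)"
      using step.IH by (auto simp: norm_mult intro!: mult_left_mono)
    also have "\<dots> + \<epsilon> * \<delta> * real n powr v = \<epsilon> * ((?t + \<delta>) * real n powr v) + M * (?t * real n powr s)"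
      by (simp add: algebra_simps)
    also have "\<dots> \<le> \<epsilon> * (real n + 1) powr (v + 1) + M * (real n + 1) powr (s + 1)"
      using N(2,3)[of n] step.hyps pos \<open>M \<ge> 0\<close> by (intro add_mono mult_left_mono) auto
    also have "\<dots> = (real n + 1) * (\<epsilon> * (real n + 1) powr v + M * (real n + 1) powr s)"
      by (simp add: powr_add algebra_simps)
    finally show ?case
      by (simp add: mult_le_cancel_left_pos add.commute)
  qed
  have "(\<lambda>n. real n powr s) \<in> o(\<lambda>n. real n powr v)"
    using s by real_asymp
  then have "(\<lambda>n. M * real n powr s) \<in> o(\<lambda>n. real n powr v)"
    by simp
  then have "eventually (\<lambda>n. M * real n powr s \<le> \<epsilon> * real n powr v) sequentially"
    using landau_o.smallD[OF _ pos(1)] \<open>M \<ge> 0\<close> by fastforce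
  with eventually_ge_at_top[of N]
  show "eventually (\<lambda>n. norm (x n) \<le> c * norm (of_real (real n powr v) :: complex)) sequentially"
  proof eventually_elim
    case (elim n)
    then show ?case using bound[of n] by (simp add: \<epsilon>_def)
  qed
qed

section \<open>Defects of the trial functions n^v and n^v H_n\<close>

lemma harm_smallo_power:
  fixes e :: real
  assumes "e > 0"
  shows "(\<lambda>n. harm n :: real) \<in> o(\<lambda>n. real n powr e)"
proof -
  have "(\<lambda>n. harm n - ln (real n) :: real) \<in> O(\<lambda>_. 1)"
    using euler_mascheroni_LIMSEQ by (intro bigoI_tendsto[where c = euler_mascheroni]) auto
  moreover have one: "(\<lambda>_::nat. 1 :: real) \<in> o(\<lambda>n. real n powr e)"
    and ln: "(\<lambda>n::nat. ln (real n)) \<in> o(\<lambda>n. real n powr e)"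
    using assms by real_asymp+
  ultimately have "(\<lambda>n. harm n - ln (real n)) \<in> o(\<lambda>n. real n powr e)"
    using landau_o.big_small_trans by blast
  from sum_in_smallo(1)[OF this ln] show ?thesis by simp
qed

text \<open>As (n + 1)^(v+1) = (n + 1) (n + 1)^v, this says that \<theta> acts on the sequence n^v
  as multiplication by v + 1, up to o(n^v).\<close>

lemma power_defect_smallo:
  fixes v :: real
  shows "(\<lambda>n. (real n + 1) powr (v + 1) - real n powr (v + 1) - (v + 1) * real n powr v) \<in> o(\<lambda>n. real n powr v)"
  by real_asymp

text \<open>A discrete product rule: the increment 1/(n + 1) of H_n turns (n + 1)^(v+1) into (n +
  1)^v, which is the extra n^v. The rest is the defect \<open>D\<close> of n^v times H_n, small
  because D = O(n^(v-1)) and H_n = o(n).\<close>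

lemma power_harm_defect_smallo:
  fixes v :: real
  shows "(\<lambda>n. (real n + 1) powr (v + 1) * harm (Suc n) - real n powr (v + 1) * harm n
      - (v + 1) * (real n powr v * harm n) - real n powr v) \<in> o(\<lambda>n. real n powr v)"
proof -
  define D where "D = (\<lambda>n. (real n + 1) powr (v + 1) - real n powr (v + 1) - (v + 1) * real n powr v)"
  have "D \<in> O(\<lambda>n. real n powr (v - 1))"
    unfolding D_def by real_asymp
  from landau_o.big_small_mult[OF this harm_smallo_power[of 1]]
  have "(\<lambda>n. D n * harm n) \<in> o(\<lambda>n. real n powr v)"
    using powr_add[of "real _" "v - 1" 1] by (simp del: powr_one flip: powr_add)
  moreover have "(\<lambda>n. (real n + 1) powr v - real n powr v) \<in> o(\<lambda>n. real n powr v)"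
    by real_asymp
  moreover have "(real n + 1) powr (v + 1) * harm (Suc n) - real n powr (v + 1) * harm n
      - (v + 1) * (real n powr v * harm n) - real n powr v = D n * harm n + ((real n + 1) powr v - real n powr v)" for n
    by (simp add: D_def harm_Suc powr_add field_simps)
  ultimately show ?thesis
    by (simp only: sum_in_smallo)
qed

section \<open>Polynomials in the Euler operator\<close>

definition euler_deriv :: "'a::comm_ring_1 fps \<Rightarrow> 'a fps" where
  "euler_deriv F = (1 - fps_X) * fps_deriv F"

text \<open>Horner's scheme for the operator p(\<theta>) applied to \<open>F\<close>.\<close>

definition euler_poly :: "'a::comm_ring_1 poly \<Rightarrow> 'a fps \<Rightarrow> 'a fps" where
  "euler_poly p F = fold_coeffs (\<lambda>c G. fps_const c * F + euler_deriv G) p 0"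

lemma euler_deriv_nth:
  "fps_nth (euler_deriv F) n = of_nat (Suc n) * fps_nth F (Suc n) - of_nat n * fps_nth F n"
  by (cases n) (simp_all add: euler_deriv_def algebra_simps)

lemma euler_deriv_0 [simp]: "euler_deriv 0 = 0"
  and euler_deriv_add: "euler_deriv (F + G) = euler_deriv F + euler_deriv G"
  and euler_deriv_cmult: "euler_deriv (fps_const c * F) = fps_const c * euler_deriv F"
  by (simp_all add: euler_deriv_def algebra_simps)

lemma euler_poly_0 [simp]: "euler_poly 0 F = 0"
  by (simp add: euler_poly_def)

lemma euler_poly_pCons:
  "euler_poly (pCons c p) F = fps_const c * F + euler_deriv (euler_poly p F)"
  by (cases "pCons c p = 0") (auto simp: euler_poly_def)

lemma euler_poly_add: "euler_poly (p + q) F = euler_poly p F + euler_poly q F"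
proof (induction p q rule: poly_induct2)
  case (pCons a p b q)
  then show ?case
    by (simp add: euler_poly_pCons euler_deriv_add algebra_simps flip: fps_const_add)
qed simp

lemma euler_poly_smult: "euler_poly (smult c p) F = fps_const c * euler_poly p F"
  by (induction p) (auto simp: euler_poly_pCons euler_deriv_cmult algebra_simps simp flip: fps_const_mult)

lemma euler_poly_const: "euler_poly [:c:] F = fps_const c * F"
  by (simp add: euler_poly_pCons)

lemma euler_poly_1: "euler_poly 1 F = F"
  by (metis euler_poly_const fps_const_1_eq_1 mult_1 one_pCons)

lemma euler_poly_mult: "euler_poly (p * q) F = euler_poly p (euler_poly q F)"
  by (induction p) (simp_all add: euler_poly_pCons euler_poly_add euler_poly_smult)

text \<open>This identifies \<theta> - l with the first-order recurrence of the previous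
  section.\<close>

lemma euler_poly_linear_nth:
  "fps_nth (euler_poly [:- l, 1:] F) n = (of_nat n + 1) * fps_nth F (Suc n) - (of_nat n + l) * fps_nth F n"
  by (simp add: euler_poly_pCons euler_deriv_nth algebra_simps)

lemma euler_poly_deriv_commute: "euler_poly p (euler_deriv F) = euler_deriv (euler_poly p F)"
  by (induction p) (simp_all add: euler_poly_pCons euler_deriv_add euler_deriv_cmult)

text \<open>Each \<theta> looks one coefficient ahead, so the constant coefficient of p(\<theta>) F
  involves only the coefficients of \<open>F\<close> up to index deg p. It yields the initial value
  once the factor \<theta> - 2 is split off.\<close>

lemma euler_poly_nth_0:
  assumes "\<And>i. i \<le> degree p \<Longrightarrow> fps_nth F i = 0"
  shows "fps_nth (euler_poly p F) 0 = 0"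
  using assms
proof (induction p arbitrary: F)
  case (pCons c p)
  show ?case
  proof (cases "p = 0")
    case False
    then have "fps_nth (euler_deriv F) i = 0" if "i \<le> degree p" for i
      using pCons.prems[of i] pCons.prems[of "Suc i"] that by (simp add: euler_deriv_nth)
    from pCons.IH[OF this] have "fps_nth (euler_deriv (euler_poly p F)) 0 = 0"
      by (simp add: euler_poly_deriv_commute)
    then show ?thesis using pCons.prems[of 0] by (simp add: euler_poly_pCons)
  qed (use pCons.prems in \<open>simp add: euler_poly_const\<close>)
qed simp

text \<open>With u = 1 - z one has \<theta>(u^k D) = -k u^k D + u^(k+1) D', so \<theta> + k takes
  u^k F^(k) to u^(k+1) F^(k+1).\<close>

lemma euler_poly_pochhammer:
  "euler_poly (pochhammer [:0, 1:] k) F = (1 - fps_X) ^ k * (fps_deriv ^^ k) F"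
proof (induction k)
  case 0
  show ?case by (simp add: euler_poly_1)
next
  case (Suc k)
  let ?D = "(fps_deriv ^^ k) F" and ?u = "1 - fps_X :: 'a fps"
  have X: "[:0, 1:] + of_nat k = [:of_nat k, 1:: 'a:]"
    by (simp add: of_nat_poly)
  have "euler_poly (pochhammer [:0, 1:] (Suc k)) F = euler_poly [:of_nat k, 1:] (?u ^ k * ?D)"
    using Suc by (simp add: pochhammer_Suc mult.commute[of "pochhammer _ _"] euler_poly_mult X
        del: mult_pCons_left mult_pCons_right)
  also have "\<dots> = of_nat k * (?u ^ k * ?D) + ?u * (?u ^ k * fps_deriv ?D - of_nat k * ?u ^ (k - 1) * ?D)"
    by (simp add: euler_poly_pCons euler_deriv_def fps_deriv_power algebra_simps fps_of_nat)
  also have "\<dots> = ?u ^ Suc k * (fps_deriv ^^ Suc k) F"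
    by (cases k) (simp_all add: algebra_simps)
  finally show ?case .
qed

lemma fps_nth_higher_deriv:
  "fps_nth ((fps_deriv ^^ k) F) n = pochhammer (of_nat (Suc n)) k * fps_nth F (n + k)"
  by (induction k arbitrary: n) (simp_all add: pochhammer_rec algebra_simps)

section \<open>Inverting polynomials in \<theta> on asymptotic expansions\<close>

lemma of_real_smallo_iff:
  "(\<lambda>n. of_real (f n) :: complex) \<in> o[F](\<lambda>n. of_real (g n)) \<longleftrightarrow> f \<in> o[F](g)"
  by (simp add: smallo_def)

text \<open>By the two defect lemmas the trial solution p n^v H_n + q n^v satisfies the recurrence
  up to o(n^v), so its difference from \<open>x\<close> falls under the little-o lemma. The
  additional \<open>p\<close> in the n^v coefficient is the product-rule term of H_n.\<close>

lemma expansion_first_order_recurrence: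
  fixes x :: "nat \<Rightarrow> complex" and l p q :: complex and v :: real
  assumes l: "Re l < v + 1"
    and x: "(\<lambda>n. (of_nat n + 1) * x (Suc n) - (of_nat n + l) * x n
        - ((of_real (v + 1) - l) * p * of_real (real n powr v * harm n)
          + ((of_real (v + 1) - l) * q + p) * of_real (real n powr v))) \<in> o(\<lambda>n. of_real (real n powr v))"
  shows "(\<lambda>n. x n - (p * of_real (real n powr v * harm n) + q * of_real (real n powr v)))
      \<in> o(\<lambda>n. of_real (real n powr v))"
proof (rule smallo_first_order_recurrence[OF l])
  define w where "w = (\<lambda>n. complex_of_real (real n powr v))"
  define h where "h = (\<lambda>n. complex_of_real (harm n))"
  define E where "E = (\<lambda>n. complex_of_real ((real n + 1) powr (v + 1) - real n powr (v + 1) - (v + 1) * real n powr v))"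
  define E' where "E' = (\<lambda>n. complex_of_real ((real n + 1) powr (v + 1) * harm (Suc n) - real n powr (v + 1) * harm n
      - (v + 1) * (real n powr v * harm n) - real n powr v))"
  define y where "y = (\<lambda>n. (of_nat n + 1) * x (Suc n) - (of_nat n + l) * x n
        - ((of_real (v + 1) - l) * p * (w n * h n) + ((of_real (v + 1) - l) * q + p) * w n))"
  \<comment> \<open>In operator form, \<open>E\<close> is \<theta>w - (v + 1) w and
    \<open>E'\<close> is \<theta>(wh) - (v + 1) wh - w.\<close>
  have E: "E n = (of_nat n + 1) * w (Suc n) - of_nat n * w n - (of_real v + 1) * w n"
    and E': "E' n = (of_nat n + 1) * w (Suc n) * h (Suc n) - of_nat n * w n * h n
      - (of_real v + 1) * (w n * h n) - w n" for n
    by (cases "n = 0"; simp add: E_def E'_def w_def h_def powr_add algebra_simps)+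
  have "(\<lambda>n. y n - (p * E' n + q * E n)) \<in> o(w)"
  proof (intro sum_in_smallo landau_o.small.cmult_in_iff')
    show "y \<in> o(w)"
      using x by (simp add: y_def w_def h_def)
    have "E \<in> o(w)" "E' \<in> o(w)"
      unfolding E_def E'_def w_def of_real_smallo_iff
      using power_defect_smallo power_harm_defect_smallo by blast+
    then show "(\<lambda>n. p * E' n) \<in> o(w)" "(\<lambda>n. q * E n) \<in> o(w)"
      by simp_all
  qed
  also have "(\<lambda>n. y n - (p * E' n + q * E n)) = (\<lambda>n. (of_nat n + 1) * (x (Suc n) - (p * (w (Suc n) * h (Suc n)) + q * w (Suc n))) -
      (of_nat n + l) * (x n - (p * (w n * h n) + q * w n)))"
    by (simp add: fun_eq_iff y_def E E' algebra_simps)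
  finally show "(\<lambda>n. (of_nat n + 1) * (x (Suc n) - (p * of_real (real (Suc n) powr v * harm (Suc n)) + q * of_real (real (Suc n) powr v))) -
      (of_nat n + l) * (x n - (p * of_real (real n powr v * harm n) + q * of_real (real n powr v)))) \<in> o(\<lambda>n. of_real (real n powr v))"
    by (simp add: w_def h_def)
qed

text \<open>Induction on the degree: split off a root, P = (X - l) R, invert \<theta> - l, then
  R(\<theta>). The coefficients match by the product rule for P'. The derivative appears because n^v
  ln n is the v-derivative of n^v, on which P(\<theta>) acts as P(v + 1) to leading order.\<close>

lemma euler_poly_expansion:
  fixes P :: "complex poly" and v :: real
  assumes "P \<noteq> 0" and "\<And>z. poly P z = 0 \<Longrightarrow> Re z < v + 1"
    and "(\<lambda>n. fps_nth (euler_poly P F) n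
        - (poly P (of_real (v + 1)) * p * of_real (real n powr v * harm n)
          + (poly P (of_real (v + 1)) * q + poly (pderiv P) (of_real (v + 1)) * p) * of_real (real n powr v)))
      \<in> o(\<lambda>n. of_real (real n powr v))"
  shows "(\<lambda>n. fps_nth F n - (p * of_real (real n powr v * harm n) + q * of_real (real n powr v)))
      \<in> o(\<lambda>n. of_real (real n powr v))"
  using assms
proof (induction "degree P" arbitrary: P p q F)
  case 0
  then obtain c where P: "P = [:c:]" "c \<noteq> 0"
    by (metis degree_eq_zeroE pCons_eq_0_iff)
  have "(\<lambda>n. c * (fps_nth F n - (p * of_real (real n powr v * harm n) + q * of_real (real n powr v))))
      \<in> o(\<lambda>n. of_real (real n powr v))"
    using "0.prems"(3) by (simp add: P euler_poly_const algebra_simps)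
  then show ?case using P(2) by simp
next
  case (Suc d)
  let ?r = "complex_of_real (v + 1)"
  obtain l where l: "poly P l = 0"
    using fundamental_theorem_of_algebra_alt[of P] Suc.hyps(2) by fastforce
  then obtain R where R: "P = [:- l, 1:] * R"
    by (auto simp: poly_eq_0_iff_dvd)
  have "R \<noteq> 0" and d: "d = degree R"
    using Suc.prems(1) Suc.hyps(2) unfolding R by (auto simp: degree_mult_eq simp del: mult_pCons_left)
  have P: "poly P ?r = (?r - l) * poly R ?r"
      "poly (pderiv P) ?r = poly R ?r + (?r - l) * poly (pderiv R) ?r"
    by (simp_all add: R pderiv_mult pderiv_pCons algebra_simps del: mult_pCons_left mult_pCons_right)
  show ?case
  proof (rule Suc.hyps(1)[OF d \<open>R \<noteq> 0\<close>])
    show "Re z < v + 1" if "poly R z = 0" for z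
      using Suc.prems(2)[of z] that by (simp add: R del: mult_pCons_left)
    show "(\<lambda>n. fps_nth (euler_poly R F) n - (poly R ?r * p * of_real (real n powr v * harm n)
          + (poly R ?r * q + poly (pderiv R) ?r * p) * of_real (real n powr v)))
      \<in> o(\<lambda>n. of_real (real n powr v))"
    proof (rule expansion_first_order_recurrence[OF Suc.prems(2)[OF l]])
      have "fps_nth (euler_poly P F) n = (of_nat n + 1) * fps_nth (euler_poly R F) (Suc n)
          - (of_nat n + l) * fps_nth (euler_poly R F) n" for n
        by (simp only: R euler_poly_mult euler_poly_linear_nth)
      moreover have "poly P ?r * p = (?r - l) * (poly R ?r * p)"
        by (simp only: P mult.assoc)
      moreover have "poly P ?r * q + poly (pderiv P) ?r * p
          = (?r - l) * (poly R ?r * q + poly (pderiv R) ?r * p) + poly R ?r * p"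
        unfolding P by algebra
      ultimately show "(\<lambda>n. (of_nat n + 1) * fps_nth (euler_poly R F) (Suc n)
          - (of_nat n + l) * fps_nth (euler_poly R F) n
          - ((?r - l) * (poly R ?r * p) * of_real (real n powr v * harm n)
            + ((?r - l) * (poly R ?r * q + poly (pderiv R) ?r * p) + poly R ?r * p)
              * of_real (real n powr v))) \<in> o(\<lambda>n. of_real (real n powr v))"
        using Suc.prems(3) by (simp only:)
    qed
  qed
qed

section \<open>The indicial polynomial\<close>

lemma poly_pochhammer: "poly (pochhammer [:0, 1:] k) x = pochhammer (x :: 'a::comm_ring_1) k"
  by (induction k) (simp_all add: pochhammer_Suc)

lemma poly_pderiv_pochhammer:
  fixes x :: "'a::field_char_0"
  assumes "\<And>i. x + of_nat i \<noteq> 0"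
  shows "poly (pderiv (pochhammer [:0, 1:] k)) x = pochhammer x k * (\<Sum>i<k. 1 / (x + of_nat i))"
proof (induction k)
  case (Suc k)
  then show ?case
    using assms[of k] by (simp add: pochhammer_Suc pderiv_mult pderiv_add pderiv_pCons poly_pochhammer field_simps flip: of_nat_poly)
qed simp

text \<open>Logarithmic differentiation: f'' = f (L^2 + L') with L = f'/f the sum of
  reciprocals.\<close>

lemma poly_pderiv2_pochhammer:
  fixes x :: "'a::field_char_0"
  assumes "\<And>i. x + of_nat i \<noteq> 0"
  shows "poly (pderiv (pderiv (pochhammer [:0, 1:] k))) x
    = pochhammer x k * ((\<Sum>i<k. 1 / (x + of_nat i))\<^sup>2 - (\<Sum>i<k. 1 / (x + of_nat i)\<^sup>2))"
proof (induction k)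
  case (Suc k)
  have step: "y * (p * (S\<^sup>2 - T)) + 2 * (p * S) = p * y * ((S + 1 / y)\<^sup>2 - (T + 1 / y\<^sup>2))"
    if "y \<noteq> 0" for y p S T :: 'a
    using that by (simp add: power2_eq_square field_simps)
  have "poly (pderiv (pderiv (pochhammer [:0, 1:] (Suc k)))) x
      = (x + of_nat k) * poly (pderiv (pderiv (pochhammer [:0, 1:] k))) x
        + 2 * poly (pderiv (pochhammer [:0, 1:] k)) x"
    by (simp add: pochhammer_Suc pderiv_mult pderiv_add pderiv_pCons algebra_simps)
  also have "\<dots> = pochhammer x k * (x + of_nat k) *
      (((\<Sum>i<k. 1 / (x + of_nat i)) + 1 / (x + of_nat k))\<^sup>2
        - ((\<Sum>i<k. 1 / (x + of_nat i)\<^sup>2) + 1 / (x + of_nat k)\<^sup>2))"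
    unfolding Suc poly_pderiv_pochhammer[OF assms] by (rule step[OF assms])
  finally show ?case
    by (simp add: pochhammer_Suc)
qed simp

lemma pochhammer_2: "pochhammer 2 k = (fact (Suc k) :: 'a::field_char_0)"
  by (induction k) (simp_all add: pochhammer_Suc algebra_simps)

text \<open>If Re z \<ge> 2 and z \<noteq> 2, every factor satisfies |z + i| > 2 + i, so the product
  has modulus greater than 2 * 3 * ... * (k + 1) = (k + 1)!.\<close>

lemma pochhammer_eq_fact_imp:
  fixes z :: complex
  assumes "k > 0" and "pochhammer z k = fact (Suc k)"
  shows "z = 2 \<or> Re z < 2"
proof (rule ccontr)
  assume "\<not> (z = 2 \<or> Re z < 2)"
  then have "z \<noteq> 2" "Re z \<ge> 2" by auto
  \<comment> \<open>On the line Re z = 2 the strictness comes from Im z \<noteq> 0, to its right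
    from the real part.\<close>
  have lt: "2 + real i < norm (z + of_nat i)" for i
  proof (cases "Re z = 2")
    case True
    with \<open>z \<noteq> 2\<close> have "Im z \<noteq> 0" by (auto simp: complex_eq_iff)
    then have "sqrt ((2 + real i)\<^sup>2) < sqrt ((2 + real i)\<^sup>2 + (Im z)\<^sup>2)"
      by (intro real_sqrt_less_mono) simp
    then show ?thesis using True by (simp add: norm_complex_def)
  next
    case False
    with \<open>Re z \<ge> 2\<close> show ?thesis
      using complex_Re_le_cmod[of "z + of_nat i"] by simp
  qed
  then have "0 < norm (z + of_nat i)" for i
    by (rule le_less_trans[rotated]) simp
  then have "(\<Prod>i<k. 2 + real i) < (\<Prod>i<k. norm (z + of_nat i))"
    using \<open>k > 0\<close> lt by (intro prod_mono_strict[of 0]) (auto intro: less_imp_le lt[of 0, simplified])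
  also have "\<dots> = norm (pochhammer z k)"
    by (simp add: pochhammer_prod prod_norm atLeast0LessThan)
  also have "\<dots> = fact (Suc k)"
    unfolding assms(2) norm_fact ..
  also have "\<dots> = (\<Prod>i<k. 2 + real i)"
    unfolding pochhammer_2[symmetric] pochhammer_prod by (simp add: atLeast0LessThan)
  finally show False by simp
qed

lemma sum_inverse_shift:
  "(\<Sum>i<k. 1 / (2 + of_nat i)) = (of_real (harm (Suc k) - 1) :: 'a::real_normed_field)"
  by (induction k) (simp_all add: harm_Suc[of "Suc _"] inverse_eq_divide harm_expand add.commute)

lemma sum_inverse_square_shift:
  "(\<Sum>i<k. 1 / (2 + of_nat i)\<^sup>2) = (of_real (harm2 (Suc k) - 1) :: 'a::real_normed_field)"
  by (induction k) (simp_all add: harm2_def add.commute)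

text \<open>Since (1 - z)^(-\<lambda>) is an eigenfunction of \<theta> with eigenvalue \<lambda>,
  the roots are the exponents of the homogeneous solutions. Growth n^v corresponds to \<lambda> = v
  + 1, so the root 2 means linear growth.\<close>

definition indicial_poly :: "nat \<Rightarrow> complex poly" where
  "indicial_poly m = pochhammer [:0, 1:] (m - 1) - [:fact m:]"

lemma poly_indicial_poly: "poly (indicial_poly m) z = pochhammer z (m - 1) - fact m"
  by (simp add: indicial_poly_def poly_pochhammer)

lemma pderiv_indicial_poly: "pderiv (indicial_poly m) = pderiv (pochhammer [:0, 1:] (m - 1))"
  by (simp add: indicial_poly_def pderiv_diff pderiv_pCons)

lemma degree_pochhammer_X: "degree (pochhammer [:0, 1:: 'a::idom:] k) = k"
proof (induction k)
  case (Suc k)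
  have X: "[:0, 1:] + of_nat k = [:of_nat k, 1:: 'a:]"
    by (simp add: of_nat_poly)
  show ?case
  proof (cases "k = 0")
    case False
    with Suc have "pochhammer [:0, 1:: 'a:] k \<noteq> 0" by auto
    with Suc show ?thesis
      by (simp add: pochhammer_Suc X degree_mult_eq del: mult_pCons_right)
  qed simp
qed simp

lemma degree_indicial_poly: "degree (indicial_poly m) = m - 1"
proof (cases "m \<le> 1")
  case False
  then show ?thesis
    unfolding indicial_poly_def diff_conv_add_uminus
    by (subst degree_add_eq_left) (simp_all add: degree_pochhammer_X)
next
  case True
  then have "m = 0 \<or> m = 1" by auto
  then show ?thesis by (auto simp: indicial_poly_def one_pCons)
qed

lemma indicial_poly_root:
  assumes "m \<ge> 2" "poly (indicial_poly m) z = 0"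
  shows "z = 2 \<or> Re z < 2"
  using pochhammer_eq_fact_imp[of "m - 1" z] assms by (simp add: poly_indicial_poly)

lemma harm_gt_1: "m \<ge> 2 \<Longrightarrow> harm m > (1 :: real)"
  using harm_mono[of 2 m, where 'a = real] by (simp add: harm_expand)

text \<open>For P = (X - 2) Q the product rule gives Q(2) = P'(2) and 2 Q'(2) = P''(2), and both
  follow from logarithmic differentiation at 2, where the rising factorial equals m!.\<close>

lemma indicial_poly_factor:
  assumes "m \<ge> 2"
  obtains Q where "indicial_poly m = [:- 2, 1:] * Q" "Q \<noteq> 0" "degree Q = m - 2"
    "poly Q 2 = of_real (fact m * (harm m - 1))"
    "poly (pderiv Q) 2 = of_real (fact m * ((harm m - 1)\<^sup>2 - (harm2 m - 1)) / 2)"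
    "\<And>z. poly Q z = 0 \<Longrightarrow> Re z < 2"
proof -
  obtain k where k: "m = Suc k" "k > 0"
    using assms by (cases m) auto
  have nz: "(2 :: complex) + of_nat i \<noteq> 0" for i
    by (simp add: complex_eq_iff)
  have poch: "pochhammer 2 k = (fact m :: complex)"
    by (simp add: pochhammer_2 k(1) del: fact_Suc)
  then have "poly (indicial_poly m) 2 = 0"
    by (simp add: poly_indicial_poly k(1) del: fact_Suc)
  then obtain Q where Q: "indicial_poly m = [:- 2, 1:] * Q"
    by (auto simp: poly_eq_0_iff_dvd)
  have "indicial_poly m \<noteq> 0"
    using degree_indicial_poly[of m] assms by auto
  then have "Q \<noteq> 0" unfolding Q by auto
  have deg: "degree Q = m - 2"
    using degree_indicial_poly[of m] \<open>Q \<noteq> 0\<close> unfolding Q by (simp add: degree_mult_eq del: mult_pCons_left)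
  have "poly (pderiv (indicial_poly m)) 2 = poly Q 2"
    by (simp add: Q pderiv_mult pderiv_pCons del: mult_pCons_left)
  then have Q2: "poly Q 2 = of_real (fact m * (harm m - 1))"
    by (simp add: pderiv_indicial_poly poly_pderiv_pochhammer nz poch sum_inverse_shift k(1) del: fact_Suc)
  have "poly (pderiv (pderiv (indicial_poly m))) 2 = 2 * poly (pderiv Q) 2"
    by (simp add: Q pderiv_mult pderiv_add pderiv_pCons del: mult_pCons_left)
  then have Q2': "poly (pderiv Q) 2 = of_real (fact m * ((harm m - 1)\<^sup>2 - (harm2 m - 1)) / 2)"
    by (simp add: pderiv_indicial_poly poly_pderiv2_pochhammer nz poch sum_inverse_shift
        sum_inverse_square_shift k(1) del: fact_Suc)
  \<comment> \<open>The root 2 is simple, so it is not a root of \<open>Q\<close> and the second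
    alternative remains.\<close>
  have "poly Q 2 \<noteq> 0"
    using harm_gt_1[OF assms] by (simp add: Q2)
  moreover have "z = 2 \<or> Re z < 2" if "poly Q z = 0" for z
    using indicial_poly_root[OF assms, of z] that unfolding Q by (simp del: mult_pCons_left)
  ultimately have "Re z < 2" if "poly Q z = 0" for z
    using that by metis
  with Q \<open>Q \<noteq> 0\<close> deg Q2 Q2' show ?thesis by (rule that)
qed

text \<open>The sum in the recurrence is the convolution of \<open>a\<close> with the coefficients
  of (1 - z)^(-k), k = m - 1. Clearing the binomial denominator turns the recurrence into (1 - z)^k
  C^(k) = m! A, and A = B + C moves m! C to the left.\<close>

lemma euler_poly_indicial_poly:
  fixes a b :: "nat \<Rightarrow> real"
  assumes m: "m \<ge> 2"
    and low: "\<And>j. j \<le> m - 2 \<Longrightarrow> a j = b j"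
    and rec: "\<And>n. n \<ge> m - 1 \<Longrightarrow> a n = b n + real m / real (n choose (m - 1)) *
        (\<Sum>j=0..n - (m - 1). real ((n - 1 - j) choose (m - 2)) * a j)"
  shows "euler_poly (indicial_poly m) (Abs_fps (\<lambda>n. of_real (a n - b n))) = fps_const (fact m) * Abs_fps (\<lambda>n. of_real (b n))"
proof -
  define k where "k = m - 1"
  have k: "k > 0" "m = Suc k" "m - 1 = k" "m - 2 = k - 1" using m by (auto simp: k_def)
  let ?A = "Abs_fps (\<lambda>n. complex_of_real (a n))" and ?B = "Abs_fps (\<lambda>n. complex_of_real (b n))"
  let ?C = "Abs_fps (\<lambda>n. complex_of_real (a n - b n))"
  let ?u = "(1 - fps_X) ^ k :: complex fps"
  have inv: "inverse ?u = Abs_fps (\<lambda>j. of_nat ((k + j - 1) choose (k - 1)))"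
  proof -
    have "k + j - 1 choose j = (k + j - 1 choose (k - 1))" for j
      using binomial_symmetric[of j "k + j - 1"] k(1) by simp
    then show ?thesis
      using one_minus_const_fps_X_neg_power'[OF k(1), of "1 :: complex"] by simp
  qed
  have "fps_nth ((fps_deriv ^^ k) ?C) n = fps_nth (fps_const (fact m) * (?A * inverse ?u)) n" for n
  proof -
    \<comment> \<open>The k-th derivative supplies exactly the denominator of the recurrence at n +
      k; the remaining k! combines with the factor m to m!.\<close>
    have "pochhammer (of_nat (Suc n)) k = (fact k * of_nat ((n + k) choose k) :: complex)"
      by (simp add: binomial_gbinomial gbinomial_pochhammer' add.commute)
    moreover have "real ((n + k) choose k) * (a (n + k) - b (n + k))
        = real m * (\<Sum>j=0..n. real ((n + k - 1 - j) choose (k - 1)) * a j)"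
      using rec[of "n + k"] by (simp add: k)
    from arg_cong[OF this, of complex_of_real]
    have "of_nat ((n + k) choose k) * complex_of_real (a (n + k) - b (n + k))
        = of_nat m * (\<Sum>j=0..n. of_nat ((n + k - 1 - j) choose (k - 1)) * of_real (a j))"
      by simp
    ultimately have "fps_nth ((fps_deriv ^^ k) ?C) n
        = fact m * (\<Sum>j=0..n. of_nat ((n + k - 1 - j) choose (k - 1)) * of_real (a j))"
      by (simp add: fps_nth_higher_deriv k(2) mult.assoc del: of_nat_Suc)
    also have "(\<Sum>j=0..n. of_nat ((n + k - 1 - j) choose (k - 1)) * complex_of_real (a j))
        = fps_nth (?A * inverse ?u) n"
      unfolding inv fps_mult_nth
      by (intro sum.cong) (auto simp: algebra_simps intro!: arg_cong2[where f = "binomial"])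
    finally show ?thesis by simp
  qed
  then have "(fps_deriv ^^ k) ?C = fps_const (fact m) * (?A * inverse ?u)"
    by (simp add: fps_eq_iff)
  then have "euler_poly (pochhammer [:0, 1:] k) ?C = fps_const (fact m) * ?A * (inverse ?u * ?u)"
    by (simp add: euler_poly_pochhammer mult_ac)
  also have "inverse ?u * ?u = 1"
    by (intro inverse_mult_eq_1) simp
  also have "fps_const (fact m) * ?A * 1 = fps_const (fact m) * ?A"
    by simp
  also have "pochhammer [:0, 1:] k = indicial_poly m + [:fact m:]"
    unfolding indicial_poly_def k(3) by (rule diff_add_cancel[symmetric])
  finally have "euler_poly (indicial_poly m) ?C + fps_const (fact m) * ?C = fps_const (fact m) * ?A"
    unfolding euler_poly_add euler_poly_const .
  then have "euler_poly (indicial_poly m) ?C = fps_const (fact m) * (?A - ?C)"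
    unfolding right_diff_distrib eq_diff_eq .
  also have "?A - ?C = ?B" by (simp add: fps_eq_iff)
  finally show ?thesis .
qed

section \<open>Transfer\<close>

lemma of_real_harm_expansion_iff:
  "(\<lambda>n. f n - (p * (real n * harm n) + q * real n)) \<in> o(\<lambda>n. real n) \<longleftrightarrow>
    (\<lambda>n. of_real (f n) - (of_real p * of_real (real n powr 1 * harm n) + of_real q * of_real (real n powr 1)))
      \<in> o(\<lambda>n. complex_of_real (real n powr 1))"
  by (subst of_real_smallo_iff[symmetric]) simp

text \<open>For v = 1 the root 2 lies on the excluded boundary Re l = v + 1. So G = Q(\<theta>) C is
  found exactly from (\<theta> - 2) G = m! B and expanded, and only \<open>Q\<close> is inverted
  asymptotically.\<close>

lemma linear_toll_transfer:
  fixes a b h :: "nat \<Rightarrow> real" and K :: real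
  assumes m: "m \<ge> 2"
    and low: "\<And>j. j \<le> m - 2 \<Longrightarrow> a j = b j"
    and rec: "\<And>n. n \<ge> m - 1 \<Longrightarrow> a n = b n + real m / real (n choose (m - 1)) *
        (\<Sum>j=0..n - (m - 1). real ((n - 1 - j) choose (m - 2)) * a j)"
    and b: "\<And>n. b n = K * (real n + 1) + h n"
    and h: "h \<in> o(\<lambda>n. real n)"
    and sm: "summable (\<lambda>n. h n / ((real n + 1) * (real n + 2)))"
  shows "(\<lambda>n. a n - (K / (harm m - 1) * real n * harm n + K3 m K h / (harm m - 1) * real n)) \<in> o(\<lambda>n. real n)"
proof -
  define C where "C = Abs_fps (\<lambda>n. complex_of_real (a n - b n))"
  obtain Q where Q: "indicial_poly m = [:- 2, 1:] * Q" "Q \<noteq> 0" "degree Q = m - 2"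
    "poly Q 2 = of_real (fact m * (harm m - 1))"
    "poly (pderiv Q) 2 = of_real (fact m * ((harm m - 1)\<^sup>2 - (harm2 m - 1)) / 2)"
    "\<And>z. poly Q z = 0 \<Longrightarrow> Re z < 2"
    using indicial_poly_factor[OF m] by blast
  define G where "G = euler_poly Q C"
  define T where "T = (\<lambda>n. \<Sum>j<n. h j / ((real j + 1) * (real j + 2)))"
  define S where "S = (\<Sum>j. h j / ((real j + 1) * (real j + 2)))"
  define H where "H = (harm m - 1 :: real)"
  define p where "p = K / H"
  \<comment> \<open>\<open>p\<close> and \<open>q\<close> describe a - b rather than
    \<open>a\<close>, hence the subtraction of the linear part \<open>K\<close> of
    \<open>b\<close>.\<close>
  define q where "q = K3 m K h / H - K"
  have H: "H > 0" using harm_gt_1[OF m] by (simp add: H_def)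
  have "euler_poly [:- 2, 1:] G = fps_const (fact m) * Abs_fps (\<lambda>n. of_real (b n))"
    unfolding G_def C_def euler_poly_mult[symmetric] Q(1)[symmetric]
    by (rule euler_poly_indicial_poly[OF m low rec])
  then have "fps_nth (euler_poly [:- 2, 1:] G) n = fact m * of_real (b n)" for n
    by simp
  then have G_rec: "(of_nat n + 1) * fps_nth G (Suc n) = (of_nat n + 2) * fps_nth G n + fact m * of_real (b n)" for n
    unfolding euler_poly_linear_nth by (simp add: algebra_simps)
  \<comment> \<open>\<open>Q\<close> has degree m - 2, and a - b vanishes up to that index by the
    initial conditions.\<close>
  have G_0: "fps_nth G 0 = 0"
    unfolding G_def by (rule euler_poly_nth_0) (use low Q(3) in \<open>auto simp: C_def\<close>)
  \<comment> \<open>Dividing the recurrence of \<open>G\<close> by (n + 1)(n + 2) makes c_n / (n +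
    1) telescope with increments m! b_n / ((n + 1)(n + 2)). The part K (n + 1) of b_n sums to K
    (H_(n+1) - 1), the part h_n to \<open>T\<close>.\<close>
  define c where "c = (\<lambda>n. fact m * (real n + 1) * (K * (harm (Suc n) - 1) + T n))"
  have c_rec: "(real n + 1) * c (Suc n) = (real n + 2) * c n + fact m * b n" for n
  proof -
    define r where "r = h n / ((real n + 1) * (real n + 2))"
    define i where "i = inverse (real n + 2)"
    have "h n = r * ((real n + 1) * (real n + 2))" and "i * (real n + 2) = 1"
      by (simp_all add: r_def i_def)
    moreover have "c (Suc n) = fact m * (real n + 2) * (K * (harm (Suc n) + i - 1) + (T n + r))"
      by (simp add: c_def harm_Suc[of "Suc n"] T_def r_def i_def add_ac)
    ultimately show ?thesis
      unfolding b c_def by algebra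
  qed
  have G_nth: "fps_nth G n = of_real (c n)" for n
  proof (induction n)
    case 0
    show ?case by (simp add: G_0 c_def T_def harm_expand)
  next
    case (Suc n)
    have "(of_nat n + 1) * fps_nth G (Suc n) = complex_of_real ((real n + 2) * c n + fact m * b n)"
      unfolding G_rec Suc.IH by simp
    also have "\<dots> = (of_nat n + 1) * of_real (c (Suc n))"
      unfolding c_rec[symmetric] by simp
    finally have "of_nat (Suc n) * fps_nth G (Suc n) = of_nat (Suc n) * of_real (c (Suc n))"
      by (simp add: add.commute)
    then show ?case
      by (simp only: mult_cancel_left of_nat_eq_0_iff nat.distinct simp_thms)
  qed
  have "(\<lambda>n. T n - S) \<in> o(\<lambda>_. 1)"
    using summable_LIMSEQ[OF sm] unfolding T_def S_def
    by (intro smalloI_tendsto) (auto simp: LIM_zero_iff)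
  moreover have "(\<lambda>n. real n + 1) \<in> O(\<lambda>n. real n)"
    by real_asymp
  ultimately have "(\<lambda>n. (real n + 1) * (T n - S)) \<in> o(\<lambda>n. real n * 1)"
    by (rule landau_o.big_small_mult[rotated])
  moreover have "(\<lambda>n. harm n) \<in> o(\<lambda>n. real n)"
    using harm_smallo_power[of 1] by simp
  moreover have const: "(\<lambda>n::nat. x) \<in> o(\<lambda>n. real n)" for x :: real
    by real_asymp
  ultimately have "(\<lambda>n. K * harm n + ((real n + 1) * (T n - S) + S)) \<in> o(\<lambda>n. real n)"
    by (intro sum_in_smallo) simp_all
  then have "(\<lambda>n. fact m * (K * harm n + ((real n + 1) * (T n - S) + S))) \<in> o(\<lambda>n. real n)"
    by simp
  \<comment> \<open>Uses (n + 1)(H_(n+1) - 1) = n H_n + H_n - n.\<close>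
  also have "(\<lambda>n. fact m * (K * harm n + ((real n + 1) * (T n - S) + S)))
      = (\<lambda>n. c n - (fact m * K * (real n * harm n) + fact m * (S - K) * real n))"
    by (simp add: fun_eq_iff c_def harm_Suc field_simps)
  finally have G_expansion: "(\<lambda>n. fps_nth G n - (of_real (fact m * K) * of_real (real n powr 1 * harm n)
      + of_real (fact m * (S - K)) * of_real (real n powr 1))) \<in> o(\<lambda>n. of_real (real n powr 1))"
    unfolding of_real_harm_expansion_iff G_nth .
  \<comment> \<open>\<open>p\<close> and \<open>q\<close> solve the triangular system Q(2) p = m! K,
    Q(2) q + Q'(2) p = m! (S - K), which is where the constant in \<open>K3\<close> comes
    from.\<close>
  have "fact m * K = fact m * H * p"
    using H by (simp add: p_def)
  then have \<alpha>: "of_real (fact m * K) = poly Q 2 * of_real p"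
    unfolding Q(4) H_def by (metis of_real_mult)
  have "fact m * (S - K) = fact m * H * q + fact m * (H\<^sup>2 - (harm2 m - 1)) / 2 * p"
    using H by (simp add: p_def q_def K3_def flip: H_def S_def) (simp add: field_simps power2_eq_square)
  then have \<beta>: "of_real (fact m * (S - K)) = poly Q 2 * of_real q + poly (pderiv Q) 2 * of_real p"
    unfolding Q(4,5) H_def by (metis of_real_mult of_real_add)
  have "(\<lambda>n. fps_nth C n - (of_real p * of_real (real n powr 1 * harm n) + of_real q * of_real (real n powr 1)))
      \<in> o(\<lambda>n. of_real (real n powr 1))"
  proof (rule euler_poly_expansion[OF Q(2)])
    show "Re z < 1 + 1" if "poly Q z = 0" for z
      using Q(6)[OF that] by simp
    have two: "complex_of_real (1 + 1) = 2" by simp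
    show "(\<lambda>n. fps_nth (euler_poly Q C) n
        - (poly Q (of_real (1 + 1)) * of_real p * of_real (real n powr 1 * harm n)
          + (poly Q (of_real (1 + 1)) * of_real q + poly (pderiv Q) (of_real (1 + 1)) * of_real p)
            * of_real (real n powr 1))) \<in> o(\<lambda>n. of_real (real n powr 1))"
      using G_expansion unfolding two \<alpha> \<beta> G_def .
  qed
  then have "(\<lambda>n. (a n - b n) - (p * (real n * harm n) + q * real n)) \<in> o(\<lambda>n. real n)"
    unfolding of_real_harm_expansion_iff by (simp add: C_def)
  moreover have "(\<lambda>n. K + h n) \<in> o(\<lambda>n. real n)"
    using h const by (intro sum_in_smallo)
  ultimately have "(\<lambda>n. ((a n - b n) - (p * (real n * harm n) + q * real n)) + (K + h n)) \<in> o(\<lambda>n. real n)"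
    by (rule sum_in_smallo)
  also have "(\<lambda>n. ((a n - b n) - (p * (real n * harm n) + q * real n)) + (K + h n))
      = (\<lambda>n. a n - (K / (harm m - 1) * real n * harm n + K3 m K h / (harm m - 1) * real n))"
    by (simp add: fun_eq_iff b p_def q_def H_def algebra_simps)
  finally show ?thesis .
qed

text \<open>Every root of \<open>P\<close> has real part at most 2 < v + 1, so P(\<theta>) is
  inverted in one go, without a harmonic term.\<close>

lemma superlinear_toll_transfer:
  fixes a b :: "nat \<Rightarrow> real" and K v :: real
  assumes m: "m \<ge> 2"
    and low: "\<And>j. j \<le> m - 2 \<Longrightarrow> a j = b j"
    and rec: "\<And>n. n \<ge> m - 1 \<Longrightarrow> a n = b n + real m / real (n choose (m - 1)) *
        (\<Sum>j=0..n - (m - 1). real ((n - 1 - j) choose (m - 2)) * a j)"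
    and v: "v > 1"
    and b: "(\<lambda>n. b n - K * real n powr v) \<in> o(\<lambda>n. real n powr v)"
  shows "(\<lambda>n. a n - K / (1 - fact m * Gamma (v + 1) / Gamma (v + real m)) * real n powr v) \<in> o(\<lambda>n. real n powr v)"
proof -
  define C where "C = Abs_fps (\<lambda>n. complex_of_real (a n - b n))"
  define g where "g = Gamma (v + real m) / Gamma (v + 1)"
  define q where "q = fact m * K / (g - fact m)"
  have Gamma_pos: "Gamma (v + 1) > 0" "Gamma (v + real m) > 0"
    using v by (auto intro!: Gamma_real_pos)
  have "v + 1 \<notin> \<int>\<^sub>\<le>\<^sub>0"
    using v by (auto elim!: nonpos_Ints_cases)
  then have g: "pochhammer (v + 1) (m - 1) = g"
    using m by (simp add: g_def pochhammer_Gamma of_nat_diff)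
  have P: "poly (indicial_poly m) (of_real (v + 1)) = of_real (g - fact m)"
    unfolding poly_indicial_poly pochhammer_of_real g by simp
  have roots: "Re z < v + 1" if "poly (indicial_poly m) z = 0" for z
    using indicial_poly_root[OF m that] v by auto
  \<comment> \<open>Otherwise v + 1 would be a root with real part v + 1.\<close>
  have "poly (indicial_poly m) (of_real (v + 1)) \<noteq> 0"
    using roots[of "of_real (v + 1)"] by auto
  then have nz: "g \<noteq> fact m" "indicial_poly m \<noteq> 0"
    using P by auto
  have "(\<lambda>n. fps_nth C n - (0 * of_real (real n powr v * harm n) + of_real q * of_real (real n powr v)))
      \<in> o(\<lambda>n. of_real (real n powr v))"
  proof (rule euler_poly_expansion[OF nz(2) roots])
    have "(\<lambda>n. fact m * (b n - K * real n powr v)) \<in> o(\<lambda>n. real n powr v)"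
      using b by simp
    then have "(\<lambda>n. of_real (fact m * (b n - K * real n powr v))) \<in> o(\<lambda>n. complex_of_real (real n powr v))"
      unfolding of_real_smallo_iff .
    moreover have "fps_nth (euler_poly (indicial_poly m) C) n = fact m * of_real (b n)" for n
      using euler_poly_indicial_poly[OF m low rec] by (simp add: C_def)
    moreover have "(g - fact m) * q = fact m * K"
      using nz by (simp add: q_def)
    then have "poly (indicial_poly m) (of_real (v + 1)) * of_real q = of_real (fact m * K)"
      unfolding P by (metis of_real_mult)
    ultimately show "(\<lambda>n. fps_nth (euler_poly (indicial_poly m) C) n
        - (poly (indicial_poly m) (of_real (v + 1)) * 0 * of_real (real n powr v * harm n)
          + (poly (indicial_poly m) (of_real (v + 1)) * of_real q + poly (pderiv (indicial_poly m)) (of_real (v + 1)) * 0)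
            * of_real (real n powr v)))
      \<in> o(\<lambda>n. of_real (real n powr v))"
      by (simp add: algebra_simps)
  qed
  also have "(\<lambda>n. fps_nth C n - (0 * of_real (real n powr v * harm n) + of_real q * of_real (real n powr v)))
      = (\<lambda>n. of_real ((a n - b n) - q * real n powr v))"
    by (simp add: C_def)
  finally have "(\<lambda>n. (a n - b n) - q * real n powr v) \<in> o(\<lambda>n. real n powr v)"
    unfolding of_real_smallo_iff .
  \<comment> \<open>Adding \<open>b\<close> back changes the coefficient to q + K.\<close>
  from sum_in_smallo(1)[OF this b]
  have "(\<lambda>n. a n - (q + K) * real n powr v) \<in> o(\<lambda>n. real n powr v)"
    by (simp add: algebra_simps)
  also have "q + K = K / (1 - fact m / g)"
    using nz Gamma_pos by (simp add: q_def g_def field_simps)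
  also have "fact m / g = fact m * Gamma (v + 1) / Gamma (v + real m)"
    by (simp add: g_def)
  finally show ?thesis .
qed

theorem theorem2p4:
  fixes m :: nat and a b :: "nat \<Rightarrow> real"
  assumes "m \<ge> 2"
    and "\<And>j. j \<le> m - 2 \<Longrightarrow> a j = b j"
    and "\<And>n. n \<ge> m - 1 \<Longrightarrow>
      a n = b n + real m / real (n choose (m - 1)) *
        (\<Sum>j=0..n - (m - 1). real ((n - 1 - j) choose (m - 2)) * a j)"
  shows
    "(b \<in> o(\<lambda>n. real n) \<longrightarrow>
      summable (\<lambda>n. b n / ((real n + 1) * (real n + 2))) \<longrightarrow>
      (\<lambda>n. a n - K1 b / (harm m - 1) * real n) \<in> o(\<lambda>n. real n))
    \<and>
    (\<forall>(K2::real) (h::nat \<Rightarrow> real).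
      (\<forall>n. b n = K2 * (real n + 1) + h n) \<longrightarrow>
      h \<in> o(\<lambda>n. real n) \<longrightarrow>
      summable (\<lambda>n. h n / ((real n + 1) * (real n + 2))) \<longrightarrow>
      (\<lambda>n. a n - (K2 / (harm m - 1) * real n * harm n + K3 m K2 h / (harm m - 1) * real n))
        \<in> o(\<lambda>n. real n))
    \<and>
    (\<forall>(K4::real) (v::real).
      v > 1 \<longrightarrow>
      (\<lambda>n. b n - K4 * real n powr v) \<in> o(\<lambda>n. real n powr v) \<longrightarrow>
      (\<lambda>n. a n - K4 / (1 - fact m * Gamma (v + 1) / Gamma (v + real m)) * real n powr v)
        \<in> o(\<lambda>n. real n powr v))"
proof (intro conjI allI impI)
  assume "b \<in> o(\<lambda>n. real n)" "summable (\<lambda>n. b n / ((real n + 1) * (real n + 2)))"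
  then show "(\<lambda>n. a n - K1 b / (harm m - 1) * real n) \<in> o(\<lambda>n. real n)"
    \<comment> \<open>Part (a) is the case K = 0, h = b, where \<open>K3\<close> reduces to
      \<open>K1\<close>.\<close>
    using linear_toll_transfer[OF assms, of 0 b] by (simp add: K1_def K3_def)
next
  fix K2 :: real and h :: "nat \<Rightarrow> real"
  assume "\<forall>n. b n = K2 * (real n + 1) + h n" "h \<in> o(\<lambda>n. real n)"
    "summable (\<lambda>n. h n / ((real n + 1) * (real n + 2)))"
  then show "(\<lambda>n. a n - (K2 / (harm m - 1) * real n * harm n + K3 m K2 h / (harm m - 1) * real n)) \<in> o(\<lambda>n. real n)"
    by (intro linear_toll_transfer[OF assms]) auto
next
  fix K4 v :: real
  assume "v > 1" "(\<lambda>n. b n - K4 * real n powr v) \<in> o(\<lambda>n. real n powr v)"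
  then show "(\<lambda>n. a n - K4 / (1 - fact m * Gamma (v + 1) / Gamma (v + real m)) * real n powr v)
      \<in> o(\<lambda>n. real n powr v)"
    using superlinear_toll_transfer[OF assms, of v K4] by blast
qed

end
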